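(* Let $\mathcal I$ be an ideal on $\mathbb N$. Then the following conditions are equivalent. (1) For every $\mathcal I^*$-nonincreasing sequence $(a_n)_{n\in\mathbb N}$ of positive reals: if $\sum_{n=1}^{\infty} a_n<\infty$ then $\mathcal I^+\text{-}\lim n a_n=0$. (2) $\mathcal I_{1/n}\cap \mathcal I^*=\emptyset$.
   Context: $\mathbb N=\{1,2,\dots\}$. An ideal on $\mathbb N$ is a nonempty family $\mathcal I\subseteq\mathcal P(\mathbb N)$ closed under subsets and finite unions, containing all finite subsets of $\mathbb N$, with $\mathbb N\notin\mathcal I$. $\mathcal I^*=\{\mathbb N\setminus A: A\in\mathcal I\}$ is the dual filter and $\mathcal I^+=\{A\subseteq\mathbb N:A\notin\mathcal I\}$ is the coideal. For a real sequence $(x_n)$, $\mathcal I^+\text{-}\lim x_n=L$ means there is $A\in\mathcal I^+$ such that the subsequence $(x_n)_{n\in A}$ converges to $L$ in the ordinary sense (such an $L$ need not be unique). A real sequence $(a_n)$ is $\mathcal I^*$-nonincreasing if there is $F\in\mathcal I^*$ such that $a_n\ge a_k$ for all $n,k\in F$ with $n\le k$. The summable ideal is $\mathcal I_{1/n}=\{A\subseteq\mathbb N:\sum_{n\in A}\frac1n<\infty\}$. *)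

theory Defs
  imports "HOL-Analysis.Analysis"
begin

text \<open>
  The index set is \<open>{1, 2, ...}\<close>. It is represented as a subset of \<^typ>\<open>nat\<close>, and a sequence
  indexed by it as a function on \<^typ>\<open>nat\<close> whose value at \<open>0\<close> is never consulted.
\<close>

abbreviation pos_nats :: "nat set" where
  "pos_nats \<equiv> {1..}"

definition is_ideal :: "nat set set \<Rightarrow> bool" where
  "is_ideal I \<longleftrightarrow>
     I \<subseteq> Pow pos_nats \<and>
     I \<noteq> {} \<and>
     (\<forall>A\<in>I. \<forall>B. B \<subseteq> A \<longrightarrow> B \<in> I) \<and>
     (\<forall>A\<in>I. \<forall>B\<in>I. A \<union> B \<in> I) \<and>
     (\<forall>A. A \<subseteq> pos_nats \<and> finite A \<longrightarrow> A \<in> I) \<and>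
     pos_nats \<notin> I"

definition dual_filter :: "nat set set \<Rightarrow> nat set set" where
  "dual_filter I = {pos_nats - A |A. A \<in> I}"

definition coideal :: "nat set set \<Rightarrow> nat set set" where
  "coideal I = {A. A \<subseteq> pos_nats \<and> A \<notin> I}"

text \<open>
  Members of the coideal of an ideal are infinite, so \<^term>\<open>enumerate A\<close> lists \<open>A\<close> in strictly
  increasing order and \<open>x \<circ> enumerate A\<close> is the subsequence of \<open>x\<close> along \<open>A\<close>.
\<close>

definition coideal_lim :: "nat set set \<Rightarrow> (nat \<Rightarrow> real) \<Rightarrow> real \<Rightarrow> bool" where
  "coideal_lim I x L \<longleftrightarrow> (\<exists>A\<in>coideal I. (x \<circ> enumerate A) \<longlonglongrightarrow> L)"

definition dual_nonincreasing :: "nat set set \<Rightarrow> (nat \<Rightarrow> real) \<Rightarrow> bool" where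
  "dual_nonincreasing I a \<longleftrightarrow>
     (\<exists>F\<in>dual_filter I. \<forall>n\<in>F. \<forall>k\<in>F. n \<le> k \<longrightarrow> a n \<ge> a k)"

definition summable_ideal :: "nat set set" where
  "summable_ideal = {A. A \<subseteq> pos_nats \<and> (\<lambda>n. 1 / real n) summable_on A}"

end

theory Submission
  imports Defs
begin

text \<open>
  If \<open>a\<close> is summable with tails \<open>r n = a n + a (n + 1) + \<dots>\<close>, the set \<open>B\<close> of all \<open>n\<close> with
  \<open>n * a n \<ge> sqrt (r n)\<close> lies in the summable ideal, because there
  \<open>1 / n \<le> a n / sqrt (r n) \<le> 2 * (sqrt (r n) - sqrt (r (n + 1)))\<close>, which telescopes. Off \<open>B\<close> we
  have \<open>n * a n < sqrt (r n)\<close>, which tends to \<open>0\<close>; and the complement of \<open>B\<close> is in the coideal unless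
  \<open>B\<close> belongs to the dual filter. Conversely, if \<open>F\<close> is
  in both families, the sequence equal to \<open>1 / n\<close> on \<open>F\<close> and to \<open>1 / n\<^sup>2\<close> elsewhere violates
  the limit condition.
\<close>

text \<open>For nonnegative terms unordered and ordered summability agree. Padding with 0 outside
  \<open>B\<close> thus makes the comparison and telescoping tests for series available for
  \<open>summable_ideal\<close>.\<close>

lemma summable_on_nat_iff_summable:
  fixes f :: "nat \<Rightarrow> real"
  assumes "\<And>n. n \<in> B \<Longrightarrow> f n \<ge> 0"
  shows "f summable_on B \<longleftrightarrow> summable (\<lambda>n. if n \<in> B then f n else 0)"
proof -
  have "f summable_on B \<longleftrightarrow> (\<lambda>n. if n \<in> B then f n else 0) summable_on UNIV"
    by (rule summable_on_cong_neutral) auto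
  also have "\<dots> \<longleftrightarrow> summable (\<lambda>n. if n \<in> B then f n else 0)"
    by (rule summable_on_UNIV_nonneg_real_iff) (use assms in auto)
  finally show ?thesis .
qed

lemma infinite_coideal:
  assumes "is_ideal I" "A \<in> coideal I"
  shows "infinite A"
  using assms unfolding is_ideal_def coideal_def by blast

text \<open>\<open>A\<close> is covered by \<open>A \<inter> F\<close> and the complement of
  \<open>F\<close>. The latter is in \<open>I\<close>, so if the former were too, \<open>A\<close>
  would be.\<close>

lemma coideal_Int_dual_filter:
  assumes I: "is_ideal I" and A: "A \<in> coideal I" and F: "F \<in> dual_filter I"
  shows "A \<inter> F \<in> coideal I"
proof -
  have "A \<inter> F \<notin> I"
  proof
    assume "A \<inter> F \<in> I"
    moreover obtain C where C: "C \<in> I" "F = pos_nats - C"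
      using F by (auto simp: dual_filter_def)
    ultimately have "(A \<inter> F) \<union> C \<in> I"
      using I by (auto simp: is_ideal_def)
    moreover have "A \<subseteq> (A \<inter> F) \<union> C"
      using A C by (auto simp: coideal_def)
    ultimately have "A \<in> I"
      using I unfolding is_ideal_def by blast
    with A show False by (simp add: coideal_def)
  qed
  with A show ?thesis by (auto simp: coideal_def)
qed

text \<open>The set \<open>A\<close> witnessing the limit meets \<open>F\<close> in an infinite set,
  so some element of \<open>F\<close> occurs in \<open>A\<close> beyond the point where the
  subsequence has become small.\<close>

lemma coideal_lim_zero_imp_small:
  assumes "is_ideal I" "coideal_lim I x 0" "F \<in> dual_filter I" "\<epsilon> > 0"
  shows "\<exists>n\<in>F. \<bar>x n\<bar> < \<epsilon>"
proof -
  obtain A where A: "A \<in> coideal I" "(x \<circ> enumerate A) \<longlonglongrightarrow> 0"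
    using assms(2) by (auto simp: coideal_lim_def)
  from LIMSEQ_D[OF A(2) assms(4)] obtain N where
    N: "\<And>k. k \<ge> N \<Longrightarrow> \<bar>x (enumerate A k)\<bar> < \<epsilon>" by auto
  have inf: "infinite (A \<inter> F)"
    using infinite_coideal coideal_Int_dual_filter A(1) assms(1,3) by blast
  then obtain n where n: "n \<in> A \<inter> F" "n > enumerate A N"
    by (meson infinite_nat_iff_unbounded)
  moreover have "infinite A" using inf by auto
  ultimately obtain k where k: "n = enumerate A k"
    using enumerate_Ex by blast
  \<comment> \<open>Otherwise \<open>enumerate A k < enumerate A N < n\<close>, contradicting the
    choice of \<open>k\<close>.\<close>
  have "k \<ge> N"
    using n(2) k \<open>infinite A\<close> by (metis enumerate_mono not_less less_imp_le not_less_iff_gr_or_eq)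
  with N[of k] k n(1) show ?thesis by auto
qed

lemma coideal_lim_of_tendsto_zero:
  assumes I: "is_ideal I" and A: "A \<in> coideal I"
    and bound: "\<And>n. n \<in> A \<Longrightarrow> \<bar>x n\<bar> \<le> s n" and s: "s \<longlonglongrightarrow> 0"
  shows "coideal_lim I x 0"
proof -
  have inf: "infinite A"
    using infinite_coideal I A .
  have "(s \<circ> enumerate A) \<longlonglongrightarrow> 0"
    using LIMSEQ_subseq_LIMSEQ[OF s strict_mono_enumerate[OF inf]] .
  then have "(x \<circ> enumerate A) \<longlonglongrightarrow> 0"
    by (rule Lim_null_comparison[rotated])
      (use bound enumerate_in_set[OF inf] in \<open>auto intro!: always_eventually\<close>)
  with A show ?thesis by (auto simp: coideal_lim_def)
qed

lemma summable_bound_off_summable_ideal: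
  fixes a :: "nat \<Rightarrow> real"
  assumes pos: "\<And>n. n \<ge> 1 \<Longrightarrow> a n > 0" and "summable a"
  obtains B s where "B \<in> summable_ideal" "s \<longlonglongrightarrow> 0"
    "\<And>n. n \<in> pos_nats - B \<Longrightarrow> \<bar>real n * a n\<bar> \<le> s n"
proof -
  define r where "r n = (\<Sum>k. a (k + n))" for n
  define s where "s n = sqrt (r n)" for n
  define B where "B = {n\<in>pos_nats. real n * a n \<ge> s n}"
  have sm: "summable (\<lambda>k. a (k + n))" for n
    using \<open>summable a\<close> by (simp add: summable_iff_shift)
  have rpos: "r n > 0" if "n \<ge> 1" for n
    unfolding r_def using that by (intro suminf_pos sm pos) auto
  have rstep: "r n = a n + r (Suc n)" for n
    using suminf_split_head[OF sm[of n]] by (simp add: r_def)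
  have "r \<longlonglongrightarrow> 0"
    unfolding r_def using suminf_exist_split2[OF \<open>summable a\<close>] .
  from tendsto_real_sqrt[OF this] have s0: "s \<longlonglongrightarrow> 0"
    by (simp add: s_def[abs_def])
  have key: "1 / real n \<le> 2 * (s n - s (Suc n))" if "n \<in> B" for n
  proof -
    have n: "n \<ge> 1" "real n * a n \<ge> s n" using that by (auto simp: B_def)
    have sp: "s n > 0" "s (Suc n) > 0" using rpos n(1) by (auto simp: s_def)
    have le: "s (Suc n) \<le> s n"
      unfolding s_def using rstep[of n] pos[OF n(1)] by simp
    \<comment> \<open>Consecutive tails differ by \<open>a n\<close>; factoring the difference of
      squares isolates the telescoping term.\<close>
    have "a n = (s n)\<^sup>2 - (s (Suc n))\<^sup>2"
      using rpos[OF n(1)] rpos[of "Suc n"] rstep[of n] by (simp add: s_def)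
    also have "\<dots> = (s n + s (Suc n)) * (s n - s (Suc n))"
      by (simp add: power2_eq_square algebra_simps)
    also have "\<dots> \<le> (2 * s n) * (s n - s (Suc n))"
      using le by (intro mult_right_mono) auto
    finally have "a n \<le> 2 * s n * (s n - s (Suc n))" .
    \<comment> \<open>Membership in \<open>B\<close> gives \<open>s n \<le> real n * a n\<close>, so
      multiplying by \<open>n\<close> puts the positive factor \<open>s n\<close> on both sides,
      where it cancels.\<close>
    then have "s n \<le> real n * (2 * s n * (s n - s (Suc n)))"
      using n(2) by (meson order_trans mult_left_mono of_nat_0_le_iff)
    then have "s n * 1 \<le> s n * (real n * (2 * (s n - s (Suc n))))"
      by (simp add: mult_ac)
    then have "1 \<le> real n * (2 * (s n - s (Suc n)))"
      using sp(1) by (simp only: mult_le_cancel_left_pos)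
    then show ?thesis using n(1) by (simp add: divide_le_eq mult.commute)
  qed
  have tel: "summable (\<lambda>n. 2 * (s n - s (Suc n)))"
    by (intro summable_mult telescope_summable'[OF s0])
  have "summable (\<lambda>n. if n \<in> B then 1 / real n else 0)"
  \<comment> \<open>The comparison starts at 1: the sign of \<open>a 0\<close> is unknown, so
    \<open>s 1 \<le> s 0\<close> may fail.\<close>
  proof (rule summable_comparison_test'[OF tel, of 1])
    fix n :: nat assume n: "n \<ge> 1"
    have "s (Suc n) \<le> s n"
      unfolding s_def using rstep[of n] pos[OF n] by simp
    then show "norm (if n \<in> B then 1 / real n else 0) \<le> 2 * (s n - s (Suc n))"
      using key[of n] by auto
  qed
  then have "B \<in> summable_ideal"
    by (auto simp: summable_ideal_def B_def summable_on_nat_iff_summable)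
  moreover have "\<bar>real n * a n\<bar> \<le> s n" if "n \<in> pos_nats - B" for n
    using that pos[of n] by (auto simp: B_def abs_mult)
  ultimately show thesis using s0 that by blast
qed

theorem theorem3p4:
  fixes I :: "nat set set"
  assumes "is_ideal I"
  shows "(\<forall>a :: nat \<Rightarrow> real.
            (\<forall>n\<in>pos_nats. a n > 0) \<and> dual_nonincreasing I a \<longrightarrow>
            summable (\<lambda>n. a (Suc n)) \<longrightarrow>
            coideal_lim I (\<lambda>n. real n * a n) 0)
         \<longleftrightarrow> summable_ideal \<inter> dual_filter I = {}"
    (is "?lim \<longleftrightarrow> ?disj")
proof
  assume lim: ?lim
  show ?disj
  proof (rule equals0I)
    fix F assume "F \<in> summable_ideal \<inter> dual_filter I"
    then have F: "F \<subseteq> pos_nats" "F \<in> dual_filter I" "(\<lambda>n. 1 / real n) summable_on F"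
      by (auto simp: summable_ideal_def)
    \<comment> \<open>On \<open>F\<close> the sequence decreases and \<open>real n * a n\<close> is
      constantly 1; off \<open>F\<close> the values only have to be positive and summable.\<close>
    define a :: "nat \<Rightarrow> real" where "a n = (if n \<in> F then 1 / real n else 1 / (real n)\<^sup>2)" for n
    have "a n > 0" if "n \<in> pos_nats" for n
      using that by (auto simp: a_def)
    moreover have "dual_nonincreasing I a"
      unfolding dual_nonincreasing_def
      using F(1) by (intro bexI[OF _ F(2)]) (force simp: a_def intro: divide_left_mono)
    moreover have "summable a"
    \<comment> \<open>The bound holds from index 0 on, because division by zero yields 0 and hence
      \<open>a 0 = 0\<close>.\<close>
    proof (rule summable_comparison_test'[of _ 0])
      have "summable (\<lambda>n. if n \<in> F then 1 / real n else 0)"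
        using F(3) by (subst (asm) summable_on_nat_iff_summable) auto
      then show "summable (\<lambda>n. (if n \<in> F then 1 / real n else 0) + inverse ((real n)\<^sup>2))"
        by (intro summable_add inverse_power_summable) auto
      show "norm (a n) \<le> (if n \<in> F then 1 / real n else 0) + inverse ((real n)\<^sup>2)" for n
        by (auto simp: a_def field_simps)
    qed
    ultimately have "coideal_lim I (\<lambda>n. real n * a n) 0"
      using lim by (auto simp: summable_Suc_iff)
    from coideal_lim_zero_imp_small[OF assms this F(2), of 1]
    obtain n where "n \<in> F" "\<bar>real n * a n\<bar> < 1" by auto
    then show False using F(1) by (auto simp: a_def)
  qed
next
  assume disj: ?disj
  show ?lim
  proof (intro allI impI, elim conjE)
    fix a :: "nat \<Rightarrow> real"
    assume pos: "\<forall>n\<in>pos_nats. a n > 0" and "summable (\<lambda>n. a (Suc n))"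
    then have "summable a" by (simp add: summable_Suc_iff)
    with pos obtain B s where B: "B \<in> summable_ideal" and s: "s \<longlonglongrightarrow> 0"
      and bound: "\<And>n. n \<in> pos_nats - B \<Longrightarrow> \<bar>real n * a n\<bar> \<le> s n"
      using summable_bound_off_summable_ideal[of a] by auto
    have "B \<subseteq> pos_nats" using B by (simp add: summable_ideal_def)
    \<comment> \<open>In this form \<open>B\<close> would belong to \<open>dual_filter I\<close> if
      its complement were in \<open>I\<close>, which \<open>disj\<close> excludes.\<close>
    then have "B = pos_nats - (pos_nats - B)" by blast
    then have "pos_nats - B \<in> coideal I"
      using disj B by (auto simp: coideal_def dual_filter_def)
    then show "coideal_lim I (\<lambda>n. real n * a n) 0"
      using coideal_lim_of_tendsto_zero[OF assms _ bound s] by blast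
  qed
qed

end
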